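(* Let $X,Y$ be jointly distributed random variables taking values in finite sets $\mathcal{X}$ and $\mathcal{Y}$. Then for every $\varepsilon>0$ there exists a public-coin protocol in which Alice receives $x$ and Bob receives $y$, with the following properties: (1) for every pair $(x,y)$ in the support of $(X,Y)$, with probability at least $1-\varepsilon$ (over the public randomness) Bob outputs $x$; (2) the expected length of the protocol (expectation over $(X,Y)$ and the public randomness) is at most $3H(X|Y)+\log_2\frac{1}{\varepsilon}+C$, where $C$ is an absolute constant; (3) the expected number of rounds of the protocol is at most $4$.
   Context: $H(X|Y)=\sum_{x,y}\Pr[X=x,Y=y]\log_2\frac{1}{\Pr[X=x\mid Y=y]}$ is the conditional Shannon entropy. A public-coin protocol is a rooted binary tree; Alice and Bob share a random string $r$ independent of $(X,Y)$; at each non-leaf vertex owned by Alice (resp. Bob) the owner sends a bit that is a function of his/her input and $r$, and they follow the correspondingly labelled edge; at the leaf reached Bob outputs a value depending on the leaf, $y$ and $r$. The length on a given run is the depth of the leaf reached; a round is a maximal block of consecutive messages sent by the same party.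
   Formalization: The error ε is restricted to 0 < ε ≤ 1, since for very large ε the claimed length bound is negative and the claim fails; the finite sets 𝒳 and 𝒴 are taken to be sets of natural numbers, which covers all finite sets by relabelling with the same C. *)

theory Defs
  imports "HOL-Probability.Probability"
begin

datatype party = Alice | Bob

text \<open>
  Public randomness is a uniformly random bit string of some fixed finite length.  The protocol
  tree is finite; each inner vertex carries the function by which its owner picks the next bit
  from their input and the public string, and each leaf carries Bob's output function.  The
  left subtree is entered on bit \<^const>\<open>False\<close>, the right one on \<^const>\<open>True\<close>.
\<close>

datatype ('x, 'y, 'z) protocol =
    Leaf "'y \<Rightarrow> bool list \<Rightarrow> 'z"
  | ANode "'x \<Rightarrow> bool list \<Rightarrow> bool" "('x, 'y, 'z) protocol" "('x, 'y, 'z) protocol"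
  | BNode "'y \<Rightarrow> bool list \<Rightarrow> bool" "('x, 'y, 'z) protocol" "('x, 'y, 'z) protocol"

definition coins :: "nat \<Rightarrow> bool list pmf" where
  "coins m = pmf_of_set {r. length r = m}"

primrec outcome :: "('x, 'y, 'z) protocol \<Rightarrow> 'x \<Rightarrow> 'y \<Rightarrow> bool list \<Rightarrow> 'z" where
  "outcome (Leaf h) x y r = h y r"
| "outcome (ANode f T0 T1) x y r = (if f x r then outcome T1 x y r else outcome T0 x y r)"
| "outcome (BNode g T0 T1) x y r = (if g y r then outcome T1 x y r else outcome T0 x y r)"

text \<open>The owners of the successive inner vertices on the path from the root to the leaf reached.\<close>

primrec speakers :: "('x, 'y, 'z) protocol \<Rightarrow> 'x \<Rightarrow> 'y \<Rightarrow> bool list \<Rightarrow> party list" where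
  "speakers (Leaf h) x y r = []"
| "speakers (ANode f T0 T1) x y r =
     Alice # (if f x r then speakers T1 x y r else speakers T0 x y r)"
| "speakers (BNode g T0 T1) x y r =
     Bob # (if g y r then speakers T1 x y r else speakers T0 x y r)"

definition run_length :: "('x, 'y, 'z) protocol \<Rightarrow> 'x \<Rightarrow> 'y \<Rightarrow> bool list \<Rightarrow> nat" where
  "run_length T x y r = length (speakers T x y r)"

text \<open>
  \<^const>\<open>remdups_adj\<close> collapses every maximal block of equal consecutive entries to one entry.
\<close>

definition run_rounds :: "('x, 'y, 'z) protocol \<Rightarrow> 'x \<Rightarrow> 'y \<Rightarrow> bool list \<Rightarrow> nat" where
  "run_rounds T x y r = length (remdups_adj (speakers T x y r))"

definition success_prob :: "nat \<Rightarrow> ('x, 'y, 'x) protocol \<Rightarrow> 'x \<Rightarrow> 'y \<Rightarrow> real" where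
  "success_prob m T x y = measure_pmf.prob (coins m) {r. outcome T x y r = x}"

definition expected_length :: "nat \<Rightarrow> ('x, 'y, 'z) protocol \<Rightarrow> ('x \<times> 'y) pmf \<Rightarrow> real" where
  "expected_length m T p =
     measure_pmf.expectation (pair_pmf p (coins m)) (\<lambda>((x, y), r). real (run_length T x y r))"

definition expected_rounds :: "nat \<Rightarrow> ('x, 'y, 'z) protocol \<Rightarrow> ('x \<times> 'y) pmf \<Rightarrow> real" where
  "expected_rounds m T p =
     measure_pmf.expectation (pair_pmf p (coins m)) (\<lambda>((x, y), r). real (run_rounds T x y r))"

text \<open>
  \<open>H(X|Y)\<close> for \<open>(X, Y)\<close> distributed according to \<open>p\<close>, with values in the finite set \<open>A \<times> B\<close>.
  Pairs outside the support contribute \<open>0\<close> because of the first factor.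
\<close>

definition cond_entropy :: "'x set \<Rightarrow> 'y set \<Rightarrow> ('x \<times> 'y) pmf \<Rightarrow> real" where
  "cond_entropy A B p =
     (\<Sum>x\<in>A. \<Sum>y\<in>B. \<P>(w in measure_pmf p. fst w = x \<and> snd w = y)
        * log 2 (1 / \<P>(w in measure_pmf p. fst w = x \<bar> snd w = y)))"

text \<open>
  HOL cannot quantify over types below \<open>\<exists>C\<close>, so the claim that one constant serves for all finite
  alphabets is phrased for finite sets of natural numbers.  The lemma \<open>transfer_alphabets\<close> below
  carries each such bound over, with the same \<open>C\<close>, to finite sets of any types.
\<close>

primrec relabel :: "('x \<Rightarrow> 'u) \<Rightarrow> ('y \<Rightarrow> 'v) \<Rightarrow> ('w \<Rightarrow> 'z) \<Rightarrow> ('u, 'v, 'w) protocol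
    \<Rightarrow> ('x, 'y, 'z) protocol" where
  "relabel f g k (Leaf h) = Leaf (\<lambda>y r. k (h (g y) r))"
| "relabel f g k (ANode a T0 T1) = ANode (\<lambda>x. a (f x)) (relabel f g k T0) (relabel f g k T1)"
| "relabel f g k (BNode b T0 T1) = BNode (\<lambda>y. b (g y)) (relabel f g k T0) (relabel f g k T1)"

lemma outcome_relabel: "outcome (relabel f g k T) x y r = k (outcome T (f x) (g y) r)"
  by (induction T) auto

lemma speakers_relabel: "speakers (relabel f g k T) x y r = speakers T (f x) (g y) r"
  by (induction T) auto

lemma expectation_relabel:
  fixes F :: "'u \<Rightarrow> 'v \<Rightarrow> 'r \<Rightarrow> real"
  shows "measure_pmf.expectation (pair_pmf p q) (\<lambda>((x, y), r). F (f x) (g y) r)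
    = measure_pmf.expectation (pair_pmf (map_pmf (map_prod f g) p) q) (\<lambda>((x, y), r). F x y r)"
proof -
  have "pair_pmf (map_pmf (map_prod f g) p) q = map_pmf (map_prod (map_prod f g) id) (pair_pmf p q)"
    using map_pair[of "map_prod f g" id p q] by (simp add: map_prod_def)
  then show ?thesis
    by (simp add: case_prod_unfold)
qed

lemma cond_entropy_relabel:
  assumes "set_pmf p \<subseteq> A \<times> B" "inj_on f A" "inj_on g B"
  shows "cond_entropy (f ` A) (g ` B) (map_pmf (map_prod f g) p) = cond_entropy A B p"
proof -
  have ev: "measure_pmf.prob p {w. P w} = measure_pmf.prob p {w. Q w}"
    if "\<And>w. w \<in> set_pmf p \<Longrightarrow> P w = Q w" for P Q
    by (rule measure_pmf.finite_measure_eq_AE) (auto simp: AE_measure_pmf_iff that)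
  have eq: "(f (fst w) = f x) = (fst w = x)" "(g (snd w) = g y) = (snd w = y)"
    if "w \<in> set_pmf p" "x \<in> A" "y \<in> B" for w x y
    using that assms by (auto simp: inj_on_eq_iff)
  show ?thesis
    unfolding cond_entropy_def cond_prob_def
    apply (simp add: sum.reindex assms)
    apply (intro sum.cong refl arg_cong2[where f = "(*)"] arg_cong[where f = "log 2"]
        arg_cong2[where f = "(/)"] ev)
      apply (auto simp: eq)
    done
qed

lemma transfer_alphabets:
  fixes A :: "'x set" and B :: "'y set" and p :: "('x \<times> 'y) pmf" and C \<epsilon> :: real
  assumes bound: "\<And>A B (p :: (nat \<times> nat) pmf). finite A \<Longrightarrow> finite B \<Longrightarrow> set_pmf p \<subseteq> A \<times> B \<Longrightarrow>
      \<exists>m T. (\<forall>(x, y) \<in> set_pmf p. success_prob m T x y \<ge> 1 - \<epsilon>)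
        \<and> expected_length m T p \<le> 3 * cond_entropy A B p + log 2 (1 / \<epsilon>) + C
        \<and> expected_rounds m T p \<le> 4"
    and fin: "finite A" "finite B" and p: "set_pmf p \<subseteq> A \<times> B"
  shows "\<exists>m T. (\<forall>(x, y) \<in> set_pmf p. success_prob m T x y \<ge> 1 - \<epsilon>)
        \<and> expected_length m T p \<le> 3 * cond_entropy A B p + log 2 (1 / \<epsilon>) + C
        \<and> expected_rounds m T p \<le> 4"
proof -
  obtain f :: "'x \<Rightarrow> nat" where f: "inj_on f A"
    using finite_imp_inj_to_nat_seg[OF fin(1)] by blast
  obtain g :: "'y \<Rightarrow> nat" where g: "inj_on g B"
    using finite_imp_inj_to_nat_seg[OF fin(2)] by blast
  define p' where "p' = map_pmf (map_prod f g) p"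
  have "set_pmf p' \<subseteq> f ` A \<times> g ` B"
    using p by (auto simp: p'_def)
  then obtain m T where T: "\<forall>(x, y) \<in> set_pmf p'. success_prob m T x y \<ge> 1 - \<epsilon>"
      "expected_length m T p' \<le> 3 * cond_entropy (f ` A) (g ` B) p' + log 2 (1 / \<epsilon>) + C"
      "expected_rounds m T p' \<le> 4"
    using bound[of "f ` A" "g ` B" p'] fin by auto
  define S where "S = relabel f g (inv_into A f) T"
  have "success_prob m S x y \<ge> 1 - \<epsilon>" if xy: "(x, y) \<in> set_pmf p" for x y
  proof -
    have "x \<in> A" using xy p by auto
    then have "success_prob m S x y \<ge> success_prob m T (f x) (g y)"
      unfolding success_prob_def S_def outcome_relabel
      by (intro measure_pmf.finite_measure_mono) (auto simp: f)
    moreover have "(f x, g y) \<in> set_pmf p'"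
      using xy by (force simp: p'_def)
    ultimately show ?thesis
      using T(1) by fastforce
  qed
  moreover have "expected_length m S p = expected_length m T p'"
    unfolding expected_length_def run_length_def S_def speakers_relabel p'_def
    by (rule expectation_relabel)
  moreover have "expected_rounds m S p = expected_rounds m T p'"
    unfolding expected_rounds_def run_rounds_def S_def speakers_relabel p'_def
    by (rule expectation_relabel)
  moreover have "cond_entropy (f ` A) (g ` B) p' = cond_entropy A B p"
    unfolding p'_def by (rule cond_entropy_relabel[OF p f g])
  ultimately show ?thesis
    using T(2,3) by (intro exI[of _ m] exI[of _ S]) auto
qed

end

theory Submission imports Defs begin

text \<open>
  Fix a step \<open>s\<close> with \<open>H(X|Y) \<le> s \<le> H(X|Y) + 2\<close> and let \<open>h(x,y) = log\<^sub>2 (1 / Pr[x|y])\<close>, so that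
  \<open>E[h] = H(X|Y)\<close>.  Alice first sends \<open>e = \<lceil>log\<^sub>2 (1/\<epsilon>)\<rceil>\<close> random hash bits of \<open>x\<close>.  In stage \<open>k\<close>
  she sends \<open>s + 1\<close> further hash bits, and Bob answers with one bit saying whether some \<open>x'\<close> with
  \<open>Pr[x'|y] \<ge> 2\<^bsup>-(k+1)s\<^esup>\<close> is consistent with all hash bits so far; if so, he outputs such an \<open>x'\<close>.
  There are at most \<open>2\<^bsup>(k+1)s\<^esup>\<close> candidates in stage \<open>k\<close>, each colliding with \<open>x\<close> with probability
  \<open>2\<^bsup>-e-(k+1)(s+1)\<^esup>\<close>, so the total error is at most \<open>2\<^bsup>-e\<^esup> \<le> \<epsilon>\<close>.  For every public string the true
  \<open>x\<close> stops the protocol after \<open>N \<le> 1 + h(x,y)/s\<close> stages, whence \<open>E[N] \<le> 2\<close>; the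
  run has \<open>e + N(s + 2)\<close> bits and \<open>2N\<close> rounds.
\<close>

section \<open>Protocol trees for sending hash bits in stages\<close>

text \<open>Continuation style: a tree records past messages only through its branching, so the
  accumulator \<open>us\<close> carries the transcript into the continuation \<open>c\<close>. The
  length of \<open>us\<close> is the index of the next bit.\<close>

primrec send_bits :: "(nat \<Rightarrow> 'x \<Rightarrow> bool list \<Rightarrow> bool) \<Rightarrow> nat \<Rightarrow> bool list
    \<Rightarrow> (bool list \<Rightarrow> ('x, 'y, 'z) protocol) \<Rightarrow> ('x, 'y, 'z) protocol" where
  "send_bits f 0 us c = c us"
| "send_bits f (Suc n) us c =
     ANode (f (length us)) (send_bits f n (us @ [False]) c) (send_bits f n (us @ [True]) c)"

definition hash :: "(nat \<Rightarrow> 'x \<Rightarrow> bool list \<Rightarrow> bool) \<Rightarrow> 'x \<Rightarrow> bool list \<Rightarrow> nat \<Rightarrow> bool list" where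
  "hash f x r n = map (\<lambda>j. f j x r) [0..<n]"

lemma length_hash [simp]: "length (hash f x r n) = n"
  by (simp add: hash_def)

lemma hash_Suc: "hash f x r n @ [f n x r] = hash f x r (Suc n)"
  by (simp add: hash_def)

lemma hash_eq_iff: "hash f x r n = hash f x' r n \<longleftrightarrow> (\<forall>j<n. f j x r = f j x' r)"
  by (auto simp: hash_def)

lemma outcome_send_bits:
  "outcome (send_bits f n (hash f x r k) c) x y r = outcome (c (hash f x r (k + n))) x y r"
proof (induction n arbitrary: k)
  case (Suc n)
  show ?case
    using Suc[of "Suc k"] hash_Suc[of f x r k] by (cases "f k x r") auto
qed simp

lemma speakers_send_bits:
  "speakers (send_bits f n (hash f x r k) c) x y r
     = replicate n Alice @ speakers (c (hash f x r (k + n))) x y r"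
proof (induction n arbitrary: k)
  case (Suc n)
  show ?case
    using Suc[of "Suc k"] hash_Suc[of f x r k] by (cases "f k x r") auto
qed simp

text \<open>Bob can compute this set: it involves only the public string, the transcript and a
  candidate set that he derives from \<open>y\<close>.\<close>

definition matching :: "(nat \<Rightarrow> 'x \<Rightarrow> bool list \<Rightarrow> bool) \<Rightarrow> 'x set \<Rightarrow> bool list \<Rightarrow> bool list \<Rightarrow> 'x set"
  where "matching f S r us = {x \<in> S. hash f x r (length us) = us}"

text \<open>The value at the leaf of the base case is irrelevant: no run on the support gets there.\<close>

primrec stages :: "(nat \<Rightarrow> 'x \<Rightarrow> bool list \<Rightarrow> bool) \<Rightarrow> nat \<Rightarrow> (nat \<Rightarrow> 'y \<Rightarrow> 'x set) \<Rightarrow> nat \<Rightarrow> nat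
    \<Rightarrow> bool list \<Rightarrow> ('x, 'y, 'x) protocol" where
  "stages f w cand 0 k us = Leaf (\<lambda>_ _. undefined)"
| "stages f w cand (Suc n) k us = send_bits f w us (\<lambda>vs.
     BNode (\<lambda>y r. matching f (cand k y) r vs \<noteq> {})
       (stages f w cand n (Suc k) vs)
       (Leaf (\<lambda>y r. SOME x. x \<in> matching f (cand k y) r vs)))"

text \<open>The public string is fixed here. The true \<open>x\<close> always agrees with its own
  hash, so stage \<open>i\<close> has a match and the run ends there at the latest; without
  collisions, any match at any stage can only be \<open>x\<close>.\<close>

lemma outcome_stages:
  assumes "x \<in> cand i y" "k \<le> i" "i < k + n"
    and no_collision: "\<And>j x'. k \<le> j \<Longrightarrow> j < k + n \<Longrightarrow> x' \<in> cand j y \<Longrightarrow>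
      hash f x' r (e + Suc j * w) = hash f x r (e + Suc j * w) \<Longrightarrow> x' = x"
  shows "outcome (stages f w cand n k (hash f x r (e + k * w))) x y r = x"
  using assms
proof (induction n arbitrary: k)
  case (Suc n)
  let ?us = "hash f x r (e + Suc k * w)"
  have unique: "x' = x" if "x' \<in> matching f (cand k y) r ?us" for x'
    using that Suc.prems(4)[of k x'] by (auto simp: matching_def)
  have out: "outcome (stages f w cand (Suc n) k (hash f x r (e + k * w))) x y r =
      (if matching f (cand k y) r ?us \<noteq> {} then SOME x. x \<in> matching f (cand k y) r ?us
       else outcome (stages f w cand n (Suc k) ?us) x y r)"
    by (simp add: outcome_send_bits ac_simps)
  show ?case
  proof (cases "matching f (cand k y) r ?us = {}")
    case True
    with Suc.prems(1) have "k \<noteq> i"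
      by (auto simp: matching_def)
    then have "outcome (stages f w cand n (Suc k) ?us) x y r = x"
    proof (intro Suc.IH)
      show "x' = x" if "Suc k \<le> j" "j < Suc k + n" "x' \<in> cand j y"
          "hash f x' r (e + Suc j * w) = hash f x r (e + Suc j * w)" for j x'
        using that by (intro Suc.prems(4)[of j x']) simp_all
    qed (use Suc.prems \<open>k \<noteq> i\<close> in auto)
    with out True show ?thesis by simp
  next
    case False
    then have "(SOME x. x \<in> matching f (cand k y) r ?us) = x"
      by (intro unique) (simp add: some_in_eq)
    with out False show ?thesis by simp
  qed
qed simp

text \<open>A false match only stops the run earlier, so this bound holds for every public string.
  \<open>N\<close> counts the stages after the first one.\<close>

lemma speakers_stages:
  assumes "x \<in> cand i y" "k \<le> i" "i < k + n"
  shows "\<exists>N. N \<le> i - k \<and> speakers (stages f w cand n k (hash f x r (e + k * w))) x y r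
    = concat (replicate (Suc N) (replicate w Alice @ [Bob]))"
  using assms
proof (induction n arbitrary: k)
  case (Suc n)
  let ?us = "hash f x r (e + Suc k * w)"
  have sp: "speakers (stages f w cand (Suc n) k (hash f x r (e + k * w))) x y r =
      replicate w Alice @ Bob # (if matching f (cand k y) r ?us \<noteq> {} then []
       else speakers (stages f w cand n (Suc k) ?us) x y r)"
    by (simp add: speakers_send_bits ac_simps)
  show ?case
  proof (cases "matching f (cand k y) r ?us = {}")
    case True
    with Suc.prems(1) have "k \<noteq> i"
      by (auto simp: matching_def)
    then have "k < i" using Suc.prems by simp
    then obtain N where N: "N \<le> i - Suc k" "speakers (stages f w cand n (Suc k) ?us) x y r
        = concat (replicate (Suc N) (replicate w Alice @ [Bob]))"
      using Suc.IH[of "Suc k"] Suc.prems by auto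
    show ?thesis
      by (rule exI[of _ "Suc N"]) (use sp True N \<open>k < i\<close> in simp)
  next
    case False
    with sp show ?thesis by (intro exI[of _ 0]) simp
  qed
qed simp

definition staged_protocol :: "(nat \<Rightarrow> 'x \<Rightarrow> bool list \<Rightarrow> bool) \<Rightarrow> nat \<Rightarrow> nat
    \<Rightarrow> (nat \<Rightarrow> 'y \<Rightarrow> 'x set) \<Rightarrow> nat \<Rightarrow> ('x, 'y, 'x) protocol" where
  "staged_protocol f e w cand n = send_bits f e [] (stages f w cand n 0)"

lemma outcome_staged_protocol:
  assumes "x \<in> cand i y" "i < n"
    and "\<And>j x'. j < n \<Longrightarrow> x' \<in> cand j y \<Longrightarrow>
      hash f x' r (e + Suc j * w) = hash f x r (e + Suc j * w) \<Longrightarrow> x' = x"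
  shows "outcome (staged_protocol f e w cand n) x y r = x"
  using outcome_send_bits[of f e x r 0 "stages f w cand n 0" y]
    outcome_stages[of x cand i y 0 n f r e w] assms
  by (simp add: staged_protocol_def hash_def)

lemma speakers_staged_protocol:
  assumes "x \<in> cand i y" "i < n"
  shows "\<exists>N\<le>i. speakers (staged_protocol f e w cand n) x y r
    = replicate e Alice @ concat (replicate (Suc N) (replicate w Alice @ [Bob]))"
  using speakers_send_bits[of f e x r 0 "stages f w cand n 0" y]
    speakers_stages[of x cand i y 0 n f w r e] assms
  by (simp add: staged_protocol_def hash_def)

section \<open>Length and number of rounds of a run\<close>

lemma length_concat_replicate: "length (concat (replicate n xs)) = n * length xs"
  by (induction n) auto

lemma length_remdups_adj_Cons_le: "length (remdups_adj (a # xs)) \<le> Suc (length (remdups_adj xs))"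
  by (cases xs) auto

lemma length_remdups_adj_replicate_append_le:
  "length (remdups_adj (replicate n a @ xs)) \<le> Suc (length (remdups_adj xs))"
proof (induction n)
  case (Suc n)
  show ?case
  proof (cases n)
    case 0
    then show ?thesis using length_remdups_adj_Cons_le[of a xs] by simp
  next
    case (Suc n')
    then show ?thesis using Suc.IH by simp
  qed
qed simp

text \<open>The initial block of \<open>e\<close> entries merges with the first block of
  \<open>w\<close>, so it costs no extra round. Generalising over \<open>e\<close> lets the
  induction step use the tail with an empty prefix.\<close>

lemma length_remdups_adj_alternating_le:
  "length (remdups_adj (replicate e a @ concat (replicate (Suc N) (replicate w a @ [b])))) \<le> 2 * Suc N"
proof (induction N arbitrary: e)
  case 0
  show ?case
    using length_remdups_adj_replicate_append_le[of "e + w" a "[b]"]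
    by (simp add: replicate_add)
next
  case (Suc N)
  let ?zs = "concat (replicate (Suc N) (replicate w a @ [b]))"
  have "replicate e a @ concat (replicate (Suc (Suc N)) (replicate w a @ [b]))
      = replicate (e + w) a @ b # ?zs"
    by (simp add: replicate_add)
  moreover have "length (remdups_adj (replicate (e + w) a @ b # ?zs)) \<le> 2 * Suc (Suc N)"
    using length_remdups_adj_replicate_append_le[of "e + w" a "b # ?zs"]
      length_remdups_adj_Cons_le[of b ?zs] Suc[of 0]
    by simp
  ultimately show ?case by (simp only:)
qed

lemma run_staged_protocol:
  assumes "x \<in> cand i y" "i < n"
  shows "run_length (staged_protocol f e w cand n) x y r \<le> e + Suc i * Suc w"
    and "run_rounds (staged_protocol f e w cand n) x y r \<le> 2 * Suc i"
proof -
  obtain N where N: "N \<le> i" "speakers (staged_protocol f e w cand n) x y r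
    = replicate e Alice @ concat (replicate (Suc N) (replicate w Alice @ [Bob]))"
    using speakers_staged_protocol[of x cand i y n, OF assms] by blast
  have "run_length (staged_protocol f e w cand n) x y r = e + Suc N * Suc w"
    unfolding run_length_def N by (simp add: length_concat_replicate)
  then show "run_length (staged_protocol f e w cand n) x y r \<le> e + Suc i * Suc w"
    using N(1) mult_le_mono1[of "Suc N" "Suc i" "Suc w"] by simp
  show "run_rounds (staged_protocol f e w cand n) x y r \<le> 2 * Suc i"
    unfolding run_rounds_def N
    by (rule order_trans[OF length_remdups_adj_alternating_le]) (use N(1) in simp)
qed

section \<open>Collision probabilities and the success probability\<close>

lemma finite_bool_lists: "finite {r :: bool list. length r = m}"
  and card_bool_lists: "card {r :: bool list. length r = m} = 2 ^ m"
  using finite_lists_length_eq[of "UNIV :: bool set" m] card_lists_length_eq[of "UNIV :: bool set" m]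
  by simp_all

text \<open>Each of the \<open>t\<close> equations fixes the entry at a fresh position
  \<open>a j\<close> through a position outside the range of \<open>a\<close>. Hence at most
  \<open>2 ^ (m - t)\<close> of the \<open>2 ^ m\<close> strings satisfy all of them.\<close>

lemma prob_coins_agree_le:
  assumes inj: "inj_on a {..<t}" and a: "\<And>j. j < t \<Longrightarrow> a j < m" and b: "\<And>j. j < t \<Longrightarrow> b j < m"
    and disj: "\<And>i j. i < t \<Longrightarrow> j < t \<Longrightarrow> a i \<noteq> b j"
  shows "measure_pmf.prob (coins m) {r. \<forall>j<t. r ! a j = r ! b j} \<le> 1 / 2 ^ t"
proof -
  define R where "R = {r :: bool list. length r = m \<and> (\<forall>j<t. r ! a j = r ! b j)}"
  define J where "J = {..<m} - a ` {..<t}"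
  have "card J = m - t"
    unfolding J_def using a inj by (subst card_Diff_subset) (auto simp: card_image)
  have "t \<le> m"
    using card_mono[of "{..<m}" "a ` {..<t}"] a by (auto simp: card_image[OF inj])
  txt \<open>A string in \<open>R\<close> is determined by its entries outside the range of \<open>a\<close>.\<close>
  have "inj_on (\<lambda>r. restrict ((!) r) J) R"
  proof (rule inj_onI)
    fix r r' assume r: "r \<in> R" "r' \<in> R" and eq: "restrict ((!) r) J = restrict ((!) r') J"
    have J: "r ! i = r' ! i" if "i \<in> J" for i
      using fun_cong[OF eq, of i] that by simp
    have "r ! i = r' ! i" if "i < m" for i
    proof (cases "i \<in> J")
      case False
      with that obtain j where j: "j < t" "i = a j" by (auto simp: J_def)
      have "b j \<in> J" using b[of j] disj[of _ j] j by (force simp: J_def)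
      then show ?thesis using J[of "b j"] j r by (auto simp: R_def)
    qed (rule J)
    then show "r = r'" using r by (auto simp: R_def intro: nth_equalityI)
  qed
  moreover have "(\<lambda>r. restrict ((!) r) J) ` R \<subseteq> J \<rightarrow>\<^sub>E UNIV"
    by auto
  moreover have "finite (J \<rightarrow>\<^sub>E (UNIV :: bool set))"
    by (intro finite_PiE) (auto simp: J_def)
  ultimately have "card R \<le> card (J \<rightarrow>\<^sub>E (UNIV :: bool set))"
    by (rule card_inj_on_le)
  also have "\<dots> = 2 ^ (m - t)"
    using \<open>card J = m - t\<close> by (subst card_PiE) (auto simp: J_def)
  finally have "real (card R) \<le> 2 ^ (m - t)"
    by (metis of_nat_le_iff of_nat_numeral of_nat_power)
  moreover have "measure_pmf.prob (coins m) {r. \<forall>j<t. r ! a j = r ! b j} = real (card R) / 2 ^ m"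
  proof -
    have "{r :: bool list. length r = m} \<noteq> {}"
      using card_bool_lists[of m] by fastforce
    moreover have "{r :: bool list. length r = m} \<inter> {r. \<forall>j<t. r ! a j = r ! b j} = R"
      by (auto simp: R_def)
    ultimately show ?thesis
      by (simp add: coins_def measure_pmf_of_set finite_bool_lists card_bool_lists)
  qed
  moreover have "(2 :: real) ^ (m - t) / 2 ^ m = 1 / 2 ^ t"
    using \<open>t \<le> m\<close> by (simp add: power_diff)
  ultimately show ?thesis
    using divide_right_mono[of "real (card R)" "2 ^ (m - t)" "2 ^ m"] by simp
qed

text \<open>The public string is read as a table with rows of length \<open>M\<close>; row
  \<open>x\<close> is the hash of \<open>x\<close>, and every stage reads a prefix of it.\<close>

definition table_bit :: "nat \<Rightarrow> nat \<Rightarrow> nat \<Rightarrow> bool list \<Rightarrow> bool" where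
  "table_bit M j x r = r ! (x * M + j)"

text \<open>Distinct inputs read distinct rows: since \<open>t \<le> M\<close>, division by
  \<open>M\<close> recovers the row from a position, so the positions compared are disjoint.\<close>

lemma prob_hash_collision_le:
  assumes "x < n" "x' < n" "x' \<noteq> x" "t \<le> M"
  shows "measure_pmf.prob (coins (n * M))
    {r. hash (table_bit M) x' r t = hash (table_bit M) x r t} \<le> 1 / 2 ^ t"
  unfolding hash_eq_iff table_bit_def
proof (rule prob_coins_agree_le)
  have in_range: "z * M + j < n * M" if "z < n" "j < t" for z j
  proof -
    have "z * M + j < Suc z * M" using that assms(4) by simp
    also have "\<dots> \<le> n * M" using that by (intro mult_le_mono1) simp
    finally show ?thesis .
  qed
  show "x' * M + j < n * M" "x * M + j < n * M" if "j < t" for j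
    using in_range assms that by auto
  show "x' * M + i \<noteq> x * M + j" if "i < t" "j < t" for i j
  proof
    assume "x' * M + i = x * M + j"
    then have "(x' * M + i) div M = (x * M + j) div M" by simp
    with that assms show False by simp
  qed
qed (simp add: inj_on_def)

text \<open>A union bound over stages and wrong candidates. The row length \<open>M\<close> is the
  number of hash bits sent if all \<open>K\<close> stages take place.\<close>

lemma success_prob_staged_protocol:
  fixes cand :: "nat \<Rightarrow> 'y \<Rightarrow> nat set" and e s K :: nat
  assumes x: "x \<in> cand i y" "i < K"
    and cand: "\<And>k. k < K \<Longrightarrow> cand k y \<subseteq> {..<n}"
    and card: "\<And>k. k < K \<Longrightarrow> card (cand k y) \<le> 2 ^ (Suc k * s)"
  defines "M \<equiv> e + K * Suc s"
  shows "success_prob (n * M) (staged_protocol (table_bit M) e (Suc s) cand K) x y \<ge> 1 - 1 / 2 ^ e"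
proof -
  let ?P = "measure_pmf.prob (coins (n * M))"
  let ?T = "staged_protocol (table_bit M) e (Suc s) cand K"
  define t where "t k = e + Suc k * Suc s" for k
  define E where "E k x' = {r. hash (table_bit M) x' r (t k) = hash (table_bit M) x r (t k)}" for k x'
  have fin: "finite (cand k y)" if "k < K" for k
    using cand[OF that] finite_subset by blast
  have collision: "?P (E k x') \<le> 1 / 2 ^ t k" if k: "k < K" and x': "x' \<in> cand k y - {x}" for k x'
    unfolding E_def
  proof (rule prob_hash_collision_le)
    show "x < n" using x cand by blast
    show "x' < n" "x' \<noteq> x" using x' cand[OF k] by auto
    have "Suc k * Suc s \<le> K * Suc s" using k by (intro mult_le_mono1) simp
    then show "t k \<le> M" by (simp add: t_def M_def)
  qed
  have stage: "?P (\<Union>x'\<in>cand k y - {x}. E k x') \<le> (1 / 2) ^ Suc k / 2 ^ e" if k: "k < K" for k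
  proof -
    have "?P (\<Union>x'\<in>cand k y - {x}. E k x') \<le> (\<Sum>x'\<in>cand k y - {x}. ?P (E k x'))"
      by (intro measure_pmf.finite_measure_subadditive_finite) (auto simp: fin[OF k])
    also have "\<dots> \<le> (\<Sum>x'\<in>cand k y - {x}. 1 / 2 ^ t k)"
      by (intro sum_mono collision k)
    also have "\<dots> = real (card (cand k y - {x})) / 2 ^ t k"
      by simp
    also have "\<dots> \<le> 2 ^ (Suc k * s) / 2 ^ t k"
    proof (intro divide_right_mono)
      have "card (cand k y - {x}) \<le> 2 ^ (Suc k * s)"
        using card[OF k] card_mono[OF fin[OF k], of "cand k y - {x}"] by (meson Diff_subset le_trans)
      then show "real (card (cand k y - {x})) \<le> 2 ^ (Suc k * s)"
        by (metis of_nat_le_iff of_nat_numeral of_nat_power)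
    qed simp
    \<comment> \<open>The \<open>s\<close> bits per stage pay for the number of candidates; the one
      surplus bit per stage leaves a geometric factor, which makes the sum over the stages at most
      1.\<close>
    also have "\<dots> = (1 / 2) ^ Suc k / 2 ^ e"
    proof -
      have "t k = Suc k * s + Suc k + e" by (simp add: t_def)
      then have "(2 :: real) ^ t k = 2 ^ (Suc k * s) * 2 ^ Suc k * 2 ^ e"
        by (simp only: power_add)
      then show ?thesis by (simp add: power_one_over divide_simps del: mult_Suc power_Suc)
    qed
    finally show ?thesis .
  qed
  \<comment> \<open>Contrapositive of \<open>outcome_staged_protocol\<close>: a wrong output forces
    a collision in some stage.\<close>
  have "?P (- {r. outcome ?T x y r = x}) \<le> ?P (\<Union>k<K. \<Union>x'\<in>cand k y - {x}. E k x')"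
  proof (intro measure_pmf.finite_measure_mono subsetI)
    fix r assume "r \<in> - {r. outcome ?T x y r = x}"
    then show "r \<in> (\<Union>k<K. \<Union>x'\<in>cand k y - {x}. E k x')"
      using outcome_staged_protocol[of x cand i y K "table_bit M" r e "Suc s", OF x]
      unfolding E_def t_def by blast
  qed simp
  also have "\<dots> \<le> (\<Sum>k<K. ?P (\<Union>x'\<in>cand k y - {x}. E k x'))"
    by (intro measure_pmf.finite_measure_subadditive_finite) auto
  also have "\<dots> \<le> (\<Sum>k<K. (1 / 2) ^ Suc k / 2 ^ e)"
    by (intro sum_mono stage) simp
  also have "\<dots> = (\<Sum>k<K. (1 / 2) ^ Suc k) / 2 ^ e"
    by (simp add: sum_divide_distrib)
  also have "(\<Sum>k<K. (1 / 2 :: real) ^ Suc k) = 1 - (1 / 2) ^ K"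
    by (induction K) (auto simp: field_simps)
  also have "(1 - (1 / 2 :: real) ^ K) / 2 ^ e \<le> 1 / 2 ^ e"
    by (intro divide_right_mono) auto
  finally have "?P (- {r. outcome ?T x y r = x}) \<le> 1 / 2 ^ e" .
  then show ?thesis
    using measure_pmf.prob_compl[of "{r. outcome ?T x y r = x}" "coins (n * M)"]
    by (simp add: success_prob_def Compl_eq_Diff_UNIV)
qed

text \<open>A bound valid for every public string removes the coins from the expectation.\<close>

lemma expectation_pair_le:
  fixes F :: "'a \<Rightarrow> 'b \<Rightarrow> real"
  assumes "finite (set_pmf p)" "finite (set_pmf q)"
    and le: "\<And>a b. a \<in> set_pmf p \<Longrightarrow> F a b \<le> G a"
  shows "measure_pmf.expectation (pair_pmf p q) (\<lambda>(a, b). F a b) \<le> measure_pmf.expectation p G"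
proof -
  have fin: "finite (set_pmf (pair_pmf p q))" using assms by simp
  have "measure_pmf.expectation (pair_pmf p q) (\<lambda>(a, b). F a b)
      \<le> measure_pmf.expectation (pair_pmf p q) (\<lambda>z. G (fst z))"
    by (intro integral_mono_AE integrable_measure_pmf_finite fin) (auto simp: AE_measure_pmf_iff le)
  also have "\<dots> = measure_pmf.expectation (map_pmf fst (pair_pmf p q)) G"
    by simp
  finally show ?thesis by (simp add: map_fst_pair_pmf)
qed

section \<open>Conditional probabilities, surprisal and entropy\<close>

definition cond_pmf_of :: "('x \<times> 'y) pmf \<Rightarrow> 'x \<Rightarrow> 'y \<Rightarrow> real" where
  "cond_pmf_of p x y = \<P>(w in measure_pmf p. fst w = x \<bar> snd w = y)"

lemma cond_pmf_of_eq:
  "cond_pmf_of p x y = pmf p (x, y) / measure_pmf.prob p {w. snd w = y}"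
proof -
  have "{w. fst w = x \<and> snd w = y} = {(x, y)}" by auto
  then show ?thesis by (simp add: cond_pmf_of_def cond_prob_def measure_pmf_single)
qed

lemma cond_pmf_of_pos:
  assumes "(x, y) \<in> set_pmf p"
  shows "0 < cond_pmf_of p x y"
proof -
  have "0 < pmf p (x, y)" using assms by (rule pmf_positive)
  moreover have "pmf p (x, y) \<le> measure_pmf.prob p {w. snd w = y}"
    by (subst measure_pmf_single[symmetric]) (intro measure_pmf.finite_measure_mono, auto)
  ultimately show ?thesis by (simp add: cond_pmf_of_eq)
qed

text \<open>Only an inequality: \<open>S\<close> may miss part of the support, and if
  \<open>y\<close> has probability 0 then every quotient is 0 by the convention for
  division.\<close>

lemma sum_cond_pmf_of_le_1:
  assumes "finite S"
  shows "(\<Sum>x\<in>S. cond_pmf_of p x y) \<le> 1"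
proof -
  have "S \<times> {y} = (\<lambda>x. (x, y)) ` S" by auto
  then have "(\<Sum>x\<in>S. pmf p (x, y)) = measure_pmf.prob p (S \<times> {y})"
    using assms by (simp add: measure_measure_pmf_finite sum.reindex inj_on_def)
  also have "\<dots> \<le> measure_pmf.prob p {w. snd w = y}"
    by (intro measure_pmf.finite_measure_mono) auto
  finally show ?thesis
    by (simp add: cond_pmf_of_eq sum_divide_distrib[symmetric] divide_le_eq_1 zero_less_measure_iff)
qed

lemma cond_pmf_of_le_1: "cond_pmf_of p x y \<le> 1"
  using sum_cond_pmf_of_le_1[of "{x}" p y] by simp

text \<open>Each member contributes at least \<open>1 / 2 ^ l\<close> to a sum that is at most 1.
  This bounds Bob's candidate sets.\<close>

lemma card_likely_le:
  assumes "finite A"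
  shows "card {x \<in> A. 1 / 2 ^ l \<le> cond_pmf_of p x y} \<le> 2 ^ l"
proof -
  let ?S = "{x \<in> A. 1 / 2 ^ l \<le> cond_pmf_of p x y}"
  have "real (card ?S) * (1 / 2 ^ l) \<le> (\<Sum>x\<in>?S. cond_pmf_of p x y)"
    by (rule sum_bounded_below) simp
  also have "\<dots> \<le> 1"
    using assms by (intro sum_cond_pmf_of_le_1) simp
  finally have "real (card ?S) \<le> real (2 ^ l)"
    by (simp add: field_simps)
  then show ?thesis by (simp only: of_nat_le_iff)
qed

text \<open>The function \<open>h\<close> of the sketch above, taken on pairs so that it can be
  integrated against \<open>p\<close>.\<close>

definition surprisal :: "('x \<times> 'y) pmf \<Rightarrow> 'x \<times> 'y \<Rightarrow> real" where
  "surprisal p z = log 2 (1 / cond_pmf_of p (fst z) (snd z))"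

lemma surprisal_nonneg:
  assumes "z \<in> set_pmf p"
  shows "0 \<le> surprisal p z"
proof -
  have "0 < cond_pmf_of p (fst z) (snd z)" using assms by (intro cond_pmf_of_pos) simp
  then show ?thesis using cond_pmf_of_le_1[of p "fst z" "snd z"] by (simp add: surprisal_def)
qed

lemma surprisal_le_iff:
  assumes "(x, y) \<in> set_pmf p"
  shows "surprisal p (x, y) \<le> real l \<longleftrightarrow> 1 / 2 ^ l \<le> cond_pmf_of p x y"
  using cond_pmf_of_pos[OF assms]
  by (simp add: surprisal_def log_le_iff powr_realpow field_simps)

lemma cond_entropy_eq_expectation:
  assumes "finite A" "finite B" "set_pmf p \<subseteq> A \<times> B"
  shows "cond_entropy A B p = measure_pmf.expectation p (surprisal p)"
proof -
  have "{w. fst w = x \<and> snd w = y} = {(x, y)}" for x :: 'a and y :: 'b by auto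
  then have "cond_entropy A B p = (\<Sum>z\<in>A \<times> B. surprisal p z * pmf p z)"
    by (simp add: cond_entropy_def surprisal_def cond_pmf_of_def measure_pmf_single
        sum.cartesian_product case_prod_unfold mult.commute)
  also have "\<dots> = measure_pmf.expectation p (surprisal p)"
    using assms by (intro integral_measure_pmf_real[symmetric]) auto
  finally show ?thesis .
qed

section \<open>Choice of parameters and the resulting expectation bounds\<close>

theorem theorem2:
  "\<exists>C :: real. \<forall>(A :: nat set) (B :: nat set) (p :: (nat \<times> nat) pmf) (\<epsilon> :: real).
     finite A \<longrightarrow> finite B \<longrightarrow> set_pmf p \<subseteq> A \<times> B \<longrightarrow> 0 < \<epsilon> \<longrightarrow> \<epsilon> \<le> 1 \<longrightarrow>
     (\<exists>(m :: nat) (T :: (nat, nat, nat) protocol).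
        (\<forall>(x, y) \<in> set_pmf p. success_prob m T x y \<ge> 1 - \<epsilon>)
      \<and> expected_length m T p \<le> 3 * cond_entropy A B p + log 2 (1 / \<epsilon>) + C
      \<and> expected_rounds m T p \<le> 4)"
proof (intro exI[of _ "7 :: real"] allI impI)
  fix A B :: "nat set" and p :: "(nat \<times> nat) pmf" and \<epsilon> :: real
  assume fin: "finite A" "finite B" and p: "set_pmf p \<subseteq> A \<times> B" and eps: "0 < \<epsilon>" "\<epsilon> \<le> 1"
  have finp: "finite (set_pmf p)" using fin p finite_subset by blast
  define H where "H = cond_entropy A B p"
  have H: "H = measure_pmf.expectation p (surprisal p)"
    unfolding H_def by (rule cond_entropy_eq_expectation[OF fin p])
  have "0 \<le> H"
    unfolding H by (intro integral_nonneg_AE) (auto simp: AE_measure_pmf_iff surprisal_nonneg)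
  \<comment> \<open>The successor keeps \<open>s\<close> positive even if \<open>H = 0\<close>;
    rounding up and adding one costs at most 2.\<close>
  define s where "s = Suc (nat \<lceil>H\<rceil>)"
  have s: "0 < real s" "H \<le> real s" "real s \<le> H + 2"
    using \<open>0 \<le> H\<close> by (simp_all add: s_def) linarith+
  define e where "e = nat \<lceil>log 2 (1 / \<epsilon>)\<rceil>"
  have "0 \<le> log 2 (1 / \<epsilon>)" using eps by simp
  then have e: "log 2 (1 / \<epsilon>) \<le> real e" "real e \<le> log 2 (1 / \<epsilon>) + 1"
    unfolding e_def by linarith+
  have "1 / 2 ^ e \<le> \<epsilon>"
    using e(1) eps by (simp add: log_le_iff powr_realpow field_simps)
  obtain n where n: "A \<subseteq> {..<n}"
    using finite_nat_set_iff_bounded fin(1) by auto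
  \<comment> \<open>The first stage, counted from 0, in which the true \<open>x\<close> is a
    candidate. Truncated subtraction gives stage 0 when the surprisal is 0.\<close>
  define g where "g z = nat \<lceil>surprisal p z / real s\<rceil> - 1" for z
  \<comment> \<open>The support is finite, so finitely many stages serve all its pairs.\<close>
  define K where "K = Suc (Max (g ` set_pmf p))"
  have g_less: "g z < K" if "z \<in> set_pmf p" for z
    using that finp by (simp add: K_def less_Suc_eq_le)
  have g_le: "real (g z) \<le> surprisal p z / real s" if "z \<in> set_pmf p" for z
  proof -
    have "0 \<le> surprisal p z / real s" using surprisal_nonneg[OF that] by simp
    then show ?thesis unfolding g_def by linarith
  qed
  define cand where "cand k y = {x \<in> A. 1 / 2 ^ (Suc k * s) \<le> cond_pmf_of p x y}" for k y
  have cand_g: "x \<in> cand (g (x, y)) y" if xy: "(x, y) \<in> set_pmf p" for x y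
  proof -
    have "surprisal p (x, y) / real s \<le> real (Suc (g (x, y)))"
      unfolding g_def by linarith
    then have "surprisal p (x, y) \<le> real (Suc (g (x, y)) * s)"
      using s(1) by (simp only: of_nat_mult pos_divide_le_eq)
    then show ?thesis
      using xy p by (auto simp only: surprisal_le_iff[OF xy] cand_def)
  qed
  define M where "M = e + K * Suc s"
  define T where "T = staged_protocol (table_bit M) e (Suc s) cand K"
  have success: "success_prob (n * M) T x y \<ge> 1 - \<epsilon>" if xy: "(x, y) \<in> set_pmf p" for x y
  proof -
    have "1 - \<epsilon> \<le> 1 - 1 / 2 ^ e" using \<open>1 / 2 ^ e \<le> \<epsilon>\<close> by simp
    also have "\<dots> \<le> success_prob (n * M) T x y"
      unfolding M_def T_def
    proof (rule success_prob_staged_protocol[where cand = cand and i = "g (x, y)", OF cand_g[OF xy] g_less[OF xy]])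
      show "cand k y \<subseteq> {..<n}" for k using n by (auto simp: cand_def)
      show "card (cand k y) \<le> 2 ^ (Suc k * s)" for k
        unfolding cand_def by (rule card_likely_le[OF fin(1)])
    qed
    finally show ?thesis .
  qed
  have fin_coins: "finite (set_pmf (coins m))" for m
  proof -
    have "{r :: bool list. length r = m} \<noteq> {}"
      using card_bool_lists[of m] by fastforce
    then show ?thesis by (simp add: coins_def set_pmf_of_set finite_bool_lists)
  qed
  have integrable: "integrable (measure_pmf p) (surprisal p)"
    by (rule integrable_measure_pmf_finite[OF finp])
  have "expected_length (n * M) T p
      \<le> measure_pmf.expectation p (\<lambda>z. real e + (1 + surprisal p z / real s) * (real s + 2))"
    unfolding expected_length_def
  proof (subst case_prod_beta', rule expectation_pair_le[unfolded case_prod_beta', OF finp fin_coins], clarsimp)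
    fix x y r assume xy: "(x, y) \<in> set_pmf p"
    \<comment> \<open>A stage costs \<open>s + 2\<close> bits: \<open>Suc s\<close> hash bits and
      Bob's reply.\<close>
    have "real (run_length T x y r) \<le> real (e + Suc (g (x, y)) * Suc (Suc s))"
      unfolding T_def of_nat_le_iff by (rule run_staged_protocol(1)[where cand = cand and i = "g (x, y)", OF cand_g[OF xy] g_less[OF xy]])
    also have "\<dots> = real e + (1 + real (g (x, y))) * (real s + 2)"
      by (simp add: algebra_simps)
    also have "\<dots> \<le> real e + (1 + surprisal p (x, y) / real s) * (real s + 2)"
      using g_le[OF xy] by (intro add_left_mono mult_right_mono) auto
    finally show "real (run_length T x y r) \<le> real e + (1 + surprisal p (x, y) / real s) * (real s + 2)" .
  qed
  also have "\<dots> = real e + (1 + H / real s) * (real s + 2)"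
    using integrable by (simp add: H)
  also have "\<dots> = real e + real s + 2 + H + 2 * (H / real s)"
    using s(1) by (simp add: field_simps)
  \<comment> \<open>The 7 collects 1 from rounding \<open>e\<close>, 2 from
    \<open>s \<le> H + 2\<close>, the explicit 2, and 2 from \<open>H / s \<le> 1\<close>. This
    yields \<open>2 * H\<close>, and \<open>0 \<le> H\<close> gives the stated coefficient.\<close>
  also have "\<dots> \<le> 3 * H + log 2 (1 / \<epsilon>) + 7"
  proof -
    have "H / real s \<le> 1" using s by simp
    then show ?thesis using s(3) e(2) \<open>0 \<le> H\<close> by linarith
  qed
  finally have len: "expected_length (n * M) T p \<le> 3 * cond_entropy A B p + log 2 (1 / \<epsilon>) + 7"
    by (simp only: H_def)
  have "expected_rounds (n * M) T p
      \<le> measure_pmf.expectation p (\<lambda>z. 2 * (1 + surprisal p z / real s))"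
    unfolding expected_rounds_def
  proof (subst case_prod_beta', rule expectation_pair_le[unfolded case_prod_beta', OF finp fin_coins], clarsimp)
    fix x y r assume xy: "(x, y) \<in> set_pmf p"
    have "real (run_rounds T x y r) \<le> real (2 * Suc (g (x, y)))"
      unfolding T_def of_nat_le_iff by (rule run_staged_protocol(2)[where cand = cand and i = "g (x, y)", OF cand_g[OF xy] g_less[OF xy]])
    also have "\<dots> \<le> 2 * (1 + surprisal p (x, y) / real s)"
      using g_le[OF xy] by simp
    finally show "real (run_rounds T x y r) \<le> 2 + 2 * surprisal p (x, y) / real s" by simp
  qed
  also have "\<dots> = 2 * (1 + H / real s)"
    using integrable by (simp add: H)
  \<comment> \<open>Here \<open>H \<le> s\<close> is what matters: the expected number of stages is
    at most 2, with two rounds each.\<close>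
  also have "\<dots> \<le> 4"
    using s(1,2) by (simp add: divide_le_eq)
  finally have rounds: "expected_rounds (n * M) T p \<le> 4" .
  show "\<exists>m T. (\<forall>(x, y) \<in> set_pmf p. success_prob m T x y \<ge> 1 - \<epsilon>)
      \<and> expected_length m T p \<le> 3 * cond_entropy A B p + log 2 (1 / \<epsilon>) + 7
      \<and> expected_rounds m T p \<le> 4"
    using success len rounds by (intro exI[of _ "n * M"] exI[of _ T]) auto
qed

end
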